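(* Let $\lambda>0$, let $\alpha:[0,\infty)\to(0,1)$ be a right-continuous piecewise constant function, and let $\{\xi^{\alpha(t)}(t)\}_{t\ge0}$, $\xi^{\alpha(t)}(t)=N(S^{\alpha(t)}(t))$, be the generalized space-fractional Poisson process via variable-order stable subordinator with rate $\lambda$ and index $\alpha(\cdot)$. Let $$\psi_{\alpha(t)}(u,t)=\mathbb{E}\left[u^{\xi^{\alpha(t)}(t)}\right]=\sum_{m=0}^\infty u^m\,\mathbb{P}[\xi^{\alpha(t)}(t)=m]$$ be its probability generating function. Then $\psi_{\alpha(t)}(u,t)$ satisfies the partial differential equation $$\frac{\partial}{\partial t}\psi_{\alpha(t)}(u,t)=-\lambda^{\alpha(t)}\,\psi_{\alpha(t)}(u,t)\,(1-u)^{\alpha(t)},\qquad \psi_{\alpha(0)}(u,0)=1.$$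
   Context: Piecewise constant index: $\alpha:[0,\infty)\to(0,1)$ is right-continuous and piecewise constant, with finitely many pieces on every bounded interval. That is, there are breakpoints $0=s_0<s_1<s_2<\cdots$ (either finitely many, with the last interval extending to $\infty$, or infinitely many with $s_j\to\infty$) and constants $\alpha_j\in(0,1)$ such that $\alpha(t)=\alpha_j$ for all $t\in[s_{j-1},s_j)$. Classical stable subordinator: for $a\in(0,1)$, an $a$-stable subordinator $\{S^{a}(t)\}_{t\ge0}$ is a nondecreasing Lévy process started at $0$ with $\mathbb{E}[e^{-w S^{a}(t)}]=e^{-t w^{a}}$ for all $t\ge0$, $w\ge0$. Variable-order stable subordinator (VOSS) with index $\alpha(\cdot)$: take independent classical stable subordinators $S^{\alpha_1},S^{\alpha_2},\ldots$, one for each interval $[s_{j-1},s_j)$, the $j$-th having index $\alpha_j$ (subordinators attached to different intervals are independent even if their indices coincide). For $t\ge0$ let $k$ be such that $s_{k-1}\le t<s_k$ (with $s_k=\infty$ if the $k$-th interval is the last one). Then $$S^{\alpha(t)}(t)=\sum_{j=1}^{k-1}S^{\alpha_j}(s_j-s_{j-1})+S^{\alpha_k}(t-s_{k-1}).$$ Generalized space-fractional Poisson process via variable-order stable subordinator: $\xi^{\alpha(t)}(t)=N(S^{\alpha(t)}(t))$, $t\ge0$, where $\{N(t)\}_{t\ge0}=\{N(t,\lambda)\}_{t\ge0}$ is a homogeneous Poisson process with rate $\lambda>0$ independent of the VOSS $\{S^{\alpha(t)}(t)\}_{t\ge0}$. The variable $u$ is the argument of the probability generating function, $u\in[-1,1]$,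 with the convention $u^0=1$.
   Formalization: At jumps of α the two-sided t-derivative of ψ generally does not exist; the equation is stated with the two-sided derivative at t>0 where α is continuous, with the right derivative at every t≥0, and with continuity of ψ(u,·) on [0,∞). *)

theory Defs
  imports "HOL-Probability.Probability"
begin

text \<open>
  Processes are functions \<open>X :: real \<Rightarrow> 'w \<Rightarrow> real\<close> of which only the restriction to times
  \<open>t \<ge> 0\<close> matters. Path properties are required for every \<open>\<omega>\<close> in the sample space rather than
  almost surely, so that the random time change \<open>\<lambda>\<omega>. N (V t \<omega>) \<omega>\<close> is measurable even if \<open>M\<close> is
  not complete.
\<close>

definition indep_increments :: "'w measure \<Rightarrow> (real \<Rightarrow> 'w \<Rightarrow> real) \<Rightarrow> bool" where
  "indep_increments M X \<longleftrightarrow>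
     (\<forall>n (t :: nat \<Rightarrow> real). 0 \<le> t 0 \<longrightarrow> (\<forall>i<n. t i \<le> t (Suc i)) \<longrightarrow>
        prob_space.indep_vars M (\<lambda>_. borel) (\<lambda>i \<omega>. X (t (Suc i)) \<omega> - X (t i) \<omega>) {..<n})"

definition stationary_increments :: "'w measure \<Rightarrow> (real \<Rightarrow> 'w \<Rightarrow> real) \<Rightarrow> bool" where
  "stationary_increments M X \<longleftrightarrow>
     (\<forall>s\<ge>0. \<forall>h\<ge>0. distr M borel (\<lambda>\<omega>. X (s + h) \<omega> - X s \<omega>) = distr M borel (\<lambda>\<omega>. X h \<omega> - X 0 \<omega>))"

definition stochastically_continuous :: "'w measure \<Rightarrow> (real \<Rightarrow> 'w \<Rightarrow> real) \<Rightarrow> bool" where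
  "stochastically_continuous M X \<longleftrightarrow>
     (\<forall>t\<ge>0. \<forall>\<epsilon>>0.
        ((\<lambda>s. measure M {\<omega> \<in> space M. \<bar>X s \<omega> - X t \<omega>\<bar> \<ge> \<epsilon>}) \<longlongrightarrow> 0) (at t within {0..}))"

definition cadlag_paths :: "'w measure \<Rightarrow> (real \<Rightarrow> 'w \<Rightarrow> real) \<Rightarrow> bool" where
  "cadlag_paths M X \<longleftrightarrow>
     (\<forall>\<omega>\<in>space M. (\<forall>t\<ge>0. continuous (at_right t) (\<lambda>s. X s \<omega>)) \<and>
        (\<forall>t>0. \<exists>l. ((\<lambda>s. X s \<omega>) \<longlongrightarrow> l) (at_left t)))"

definition levy_process :: "'w measure \<Rightarrow> (real \<Rightarrow> 'w \<Rightarrow> real) \<Rightarrow> bool" where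
  "levy_process M X \<longleftrightarrow>
     (\<forall>t\<ge>0. X t \<in> borel_measurable M) \<and>
     (\<forall>\<omega>\<in>space M. X 0 \<omega> = 0) \<and>
     indep_increments M X \<and>
     stationary_increments M X \<and>
     stochastically_continuous M X \<and>
     cadlag_paths M X"

definition nondecreasing_paths :: "'w measure \<Rightarrow> (real \<Rightarrow> 'w \<Rightarrow> real) \<Rightarrow> bool" where
  "nondecreasing_paths M X \<longleftrightarrow> (\<forall>\<omega>\<in>space M. mono_on {0..} (\<lambda>t. X t \<omega>))"

definition stable_subordinator :: "'w measure \<Rightarrow> real \<Rightarrow> (real \<Rightarrow> 'w \<Rightarrow> real) \<Rightarrow> bool" where
  "stable_subordinator M a X \<longleftrightarrow>
     0 < a \<and> a < 1 \<and>
     levy_process M X \<and>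
     nondecreasing_paths M X \<and>
     (\<forall>t\<ge>0. \<forall>w\<ge>0. (\<integral>\<omega>. exp (- w * X t \<omega>) \<partial>M) = exp (- t * w powr a))"

text \<open>
  The marginal law at \<open>t > 0\<close> together with stationarity gives Poisson increments; at \<open>t = 0\<close> the
  process vanishes (and \<open>poisson_pmf\<close> is only specified for positive rates).
\<close>

definition poisson_process :: "'w measure \<Rightarrow> real \<Rightarrow> (real \<Rightarrow> 'w \<Rightarrow> nat) \<Rightarrow> bool" where
  "poisson_process M lam N \<longleftrightarrow>
     0 < lam \<and>
     levy_process M (\<lambda>t \<omega>. real (N t \<omega>)) \<and>
     nondecreasing_paths M (\<lambda>t \<omega>. real (N t \<omega>)) \<and>
     (\<forall>t\<ge>0. N t \<in> measurable M (count_space UNIV)) \<and>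
     (\<forall>t>0. distr M (count_space UNIV) (N t) = measure_pmf (poisson_pmf (lam * t)))"

text \<open>
  Breakpoints are extended reals \<open>0 = s 0 < s 1 < \<dots>\<close> tending to \<open>\<infinity>\<close>. If there are only finitely
  many pieces, the last one ends at \<open>s k = \<infinity>\<close>, and \<open>s\<close> stays at \<open>\<infinity>\<close> from then on. The pieces are
  numbered from \<open>1\<close>: the \<open>j\<close>-th one is \<open>[s (j - 1), s j)\<close>, present iff \<open>s (j - 1) < \<infinity>\<close>.
\<close>

definition breakpoints :: "(nat \<Rightarrow> ereal) \<Rightarrow> bool" where
  "breakpoints s \<longleftrightarrow>
     s 0 = 0 \<and> mono s \<and> (\<forall>j. s j < \<infinity> \<longrightarrow> s j < s (Suc j)) \<and> s \<longlonglongrightarrow> \<infinity>"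

definition pieces :: "(nat \<Rightarrow> ereal) \<Rightarrow> nat set" where
  "pieces s = {j. 1 \<le> j \<and> s (j - 1) < \<infinity>}"

definition piecewise_constant_index ::
    "(nat \<Rightarrow> ereal) \<Rightarrow> (nat \<Rightarrow> real) \<Rightarrow> (real \<Rightarrow> real) \<Rightarrow> bool" where
  "piecewise_constant_index s a \<alpha> \<longleftrightarrow>
     breakpoints s \<and>
     (\<forall>j\<in>pieces s. 0 < a j \<and> a j < 1 \<and>
        (\<forall>t. s (j - 1) \<le> ereal t \<and> ereal t < s j \<longrightarrow> \<alpha> t = a j))"

definition piece_at :: "(nat \<Rightarrow> ereal) \<Rightarrow> real \<Rightarrow> nat" where
  "piece_at s t = (THE k. 1 \<le> k \<and> s (k - 1) \<le> ereal t \<and> ereal t < s k)"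

lemma piece_at_unique:
  assumes "breakpoints s" and "0 \<le> t"
  shows "\<exists>!k. 1 \<le> k \<and> s (k - 1) \<le> ereal t \<and> ereal t < s k"
proof -
  have mono: "mono s" and s0: "s 0 = 0" and lim: "s \<longlonglongrightarrow> \<infinity>"
    using assms(1) by (auto simp: breakpoints_def)
  have "\<forall>\<^sub>F j in sequentially. ereal t < s j"
    using order_tendstoD(1)[OF lim, of "ereal t"] by simp
  then have ex: "\<exists>j. ereal t < s j"
    by (auto simp: eventually_sequentially)
  define k where "k = (LEAST j. ereal t < s j)"
  have k: "ereal t < s k"
    unfolding k_def using ex by (rule LeastI_ex)
  have k0: "k \<noteq> 0"
    using k s0 assms(2) by (metis ereal_less_eq(5) not_less)
  have "\<not> ereal t < s (k - 1)"
    using not_less_Least[of "k - 1" "\<lambda>j. ereal t < s j"] k0 by (simp add: k_def)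
  then have P: "1 \<le> k \<and> s (k - 1) \<le> ereal t \<and> ereal t < s k"
    using k k0 by auto
  have le: "i \<le> j" if "1 \<le> i" "s (i - 1) \<le> ereal t" "ereal t < s j" for i j
  proof (rule ccontr)
    assume "\<not> i \<le> j"
    then have "s j \<le> s (i - 1)"
      using mono by (auto intro: monoD)
    then show False
      using that by (meson leD order.trans)
  qed
  show ?thesis
    using P le by (intro ex1I[of _ k]) (auto intro: antisym)
qed

definition voss ::
    "(nat \<Rightarrow> ereal) \<Rightarrow> (nat \<Rightarrow> real \<Rightarrow> 'w \<Rightarrow> real) \<Rightarrow> real \<Rightarrow> 'w \<Rightarrow> real" where
  "voss s S t \<omega> =
     (let k = piece_at s t in
        (\<Sum>j = 1..k - 1. S j (real_of_ereal (s j - s (j - 1))) \<omega>)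
          + S k (t - real_of_ereal (s (k - 1))) \<omega>)"

text \<open>Processes as random elements of the product space, to express independence of processes.\<close>

definition sample_path :: "(real \<Rightarrow> 'w \<Rightarrow> real) \<Rightarrow> 'w \<Rightarrow> real \<Rightarrow> real" where
  "sample_path X \<omega> = (\<lambda>t\<in>{0..}. X t \<omega>)"

definition indep_processes ::
    "'w measure \<Rightarrow> (real \<Rightarrow> 'w \<Rightarrow> real) \<Rightarrow> (real \<Rightarrow> 'w \<Rightarrow> real) \<Rightarrow> bool" where
  "indep_processes M X Y \<longleftrightarrow>
     prob_space.indep_var M (PiM {0..} (\<lambda>_. borel)) (sample_path X)
       (PiM {0..} (\<lambda>_. borel)) (sample_path Y)"

definition indep_stable_family ::
    "'w measure \<Rightarrow> (nat \<Rightarrow> ereal) \<Rightarrow> (nat \<Rightarrow> real) \<Rightarrow> (nat \<Rightarrow> real \<Rightarrow> 'w \<Rightarrow> real) \<Rightarrow> bool" where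
  "indep_stable_family M s a S \<longleftrightarrow>
     (\<forall>j\<in>pieces s. stable_subordinator M (a j) (S j)) \<and>
     prob_space.indep_vars M (\<lambda>_. PiM {0..} (\<lambda>_. borel)) (\<lambda>j. sample_path (S j)) (pieces s)"

definition time_change :: "(real \<Rightarrow> 'w \<Rightarrow> nat) \<Rightarrow> (real \<Rightarrow> 'w \<Rightarrow> real) \<Rightarrow> real \<Rightarrow> 'w \<Rightarrow> nat" where
  "time_change N V t \<omega> = N (V t \<omega>) \<omega>"

definition pgf :: "'w measure \<Rightarrow> ('w \<Rightarrow> nat) \<Rightarrow> real \<Rightarrow> real" where
  "pgf M X u = (\<integral>\<omega>. u ^ X \<omega> \<partial>M)"

lemma pgf_sums:
  assumes "prob_space M" and X: "X \<in> measurable M (count_space UNIV)" and u: "u \<in> {-1..1}"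
  shows "(\<lambda>m. u ^ m * measure M {\<omega> \<in> space M. X \<omega> = m}) sums pgf M X u"
proof -
  interpret prob_space M by fact
  note X[measurable]
  define A where "A m = {\<omega> \<in> space M. X \<omega> = m}" for m
  have A[measurable]: "A m \<in> sets M" for m
    unfolding A_def by measurable
  define f where "f m \<omega> = u ^ m * indicator (A m) \<omega>" for m \<omega>
  have int: "integrable M (f m)" for m
    unfolding f_def by (auto simp: emeasure_eq_measure)
  have off: "f m \<omega> = 0" if "\<omega> \<in> space M" "m \<noteq> X \<omega>" for m \<omega>
    using that by (simp add: f_def A_def indicator_def)
  have summ: "summable (\<lambda>m. norm (f m \<omega>))" if "\<omega> \<in> space M" for \<omega>
    using off[OF that] by (intro summable_finite[of "{X \<omega>}"]) auto
  have "(\<lambda>m. measure M (A m)) sums measure M (\<Union>m. A m)"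
    by (intro finite_measure_UNION) (auto simp: disjoint_family_on_def A_def)
  then have sA: "summable (\<lambda>m. measure M (A m))"
    by (rule sums_summable)
  have nrm: "(\<integral>\<omega>. norm (f m \<omega>) \<partial>M) = \<bar>u\<bar> ^ m * measure M (A m)" for m
    by (simp add: f_def abs_mult power_abs)
  have le1: "\<bar>u\<bar> ^ m \<le> 1" for m
    using u by (intro power_le_one) auto
  have sI: "summable (\<lambda>m. \<integral>\<omega>. norm (f m \<omega>) \<partial>M)"
    unfolding nrm
    by (rule summable_comparison_test'[OF sA, of 0])
       (use le1 in \<open>auto simp: abs_mult intro!: mult_left_le_one_le\<close>)
  have "(\<lambda>m. integral\<^sup>L M (f m)) sums (\<integral>\<omega>. (\<Sum>m. f m \<omega>) \<partial>M)"
    using int summ sI by (intro sums_integral) auto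
  moreover have "integral\<^sup>L M (f m) = u ^ m * measure M (A m)" for m
    by (simp add: f_def[abs_def])
  moreover have "(\<integral>\<omega>. (\<Sum>m. f m \<omega>) \<partial>M) = pgf M X u"
    unfolding pgf_def
  proof (rule Bochner_Integration.integral_cong[OF refl])
    fix \<omega> assume w: "\<omega> \<in> space M"
    have "(\<Sum>m. f m \<omega>) = (\<Sum>m\<in>{X \<omega>}. f m \<omega>)"
      using off[OF w] by (intro suminf_finite) auto
    then show "(\<Sum>m. f m \<omega>) = u ^ X \<omega>"
      using w by (simp add: f_def A_def)
  qed
  ultimately show ?thesis
    by (simp add: A_def)
qed

end

theory Submission
  imports Defs
begin

text \<open>
  Condition on the random clock \<open>V = voss s S\<close>: since \<open>N\<close> is independent of \<open>V\<close> and \<open>N t\<close> has generating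
  function \<open>exp (- lam (1 - u) t)\<close>, the generating function of \<open>N\<close> at the time \<open>V t\<close> is the Laplace
  transform of \<open>V t\<close> at \<open>w = lam (1 - u)\<close> (\<open>pgf_time_change\<close>, \<open>poisson_process_pgf\<close>). The value
  \<open>V t\<close> is a sum of independent stable increments, one for each piece met before time \<open>t\<close>, so its
  Laplace transform is \<open>exp\<close> of minus a sum of terms \<open>duration * w powr a j\<close>
  (\<open>voss_laplace_transform\<close>). This exponent is affine in \<open>t\<close> on each piece, with slope
  \<open>w powr \<alpha> t = lam powr \<alpha> t * (1 - u) powr \<alpha> t\<close>, which is the differential equation inside a piece.

  At a breakpoint the exponents of the two adjacent pieces agree
  (\<open>voss_exponent_at_breakpoint\<close>), so the generating function follows the formula of a piece on the
  closed interval. Hence a one-sided derivative exists on either side of every time, the right one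
  governed by \<open>\<alpha> t\<close> and the left one by the left limit of \<open>\<alpha>\<close>. Existence of both gives continuity,
  and where \<open>\<alpha>\<close> is continuous the two derivatives coincide.
\<close>

section \<open>Generating functions under an independent random time change\<close>

lemma poisson_process_pgf:
  assumes "prob_space M" and N: "poisson_process M lam N" and u: "u \<in> {-1..1}" and t: "0 \<le> t"
  shows "pgf M (N t) u = exp (- (lam * (1 - u)) * t)"
proof (cases "t = 0")
  case True
  interpret prob_space M by fact
  have "N 0 \<omega> = 0" if "\<omega> \<in> space M" for \<omega>
    using N that by (auto simp: poisson_process_def levy_process_def)
  then have "pgf M (N 0) u = (\<integral>\<omega>. 1 \<partial>M)"
    unfolding pgf_def by (intro Bochner_Integration.integral_cong) auto
  then show ?thesis
    using True by (simp add: prob_space)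
next
  case False
  interpret prob_space M by fact
  have pos: "0 < lam * t"
    using N t False by (auto simp: poisson_process_def)
  have meas[measurable]: "N t \<in> measurable M (count_space UNIV)"
    using N t by (auto simp: poisson_process_def)
  have law: "distr M (count_space UNIV) (N t) = measure_pmf (poisson_pmf (lam * t))"
    using N t False by (auto simp: poisson_process_def)
  have "measure M {\<omega> \<in> space M. N t \<omega> = m} = exp (- (lam * t)) * ((lam * t) ^ m / fact m)" for m
  proof -
    have "measure M {\<omega> \<in> space M. N t \<omega> = m} = measure (distr M (count_space UNIV) (N t)) {m}"
      by (subst measure_distr) (auto intro!: arg_cong[where f="measure M"])
    then show ?thesis
      unfolding law using pos by (simp add: measure_pmf_single)
  qed
  then have "(\<lambda>m. u ^ m * (exp (- (lam * t)) * ((lam * t) ^ m / fact m))) sums pgf M (N t) u"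
    using pgf_sums[OF assms(1) meas u] by simp
  moreover have "(\<lambda>m. u ^ m * (exp (- (lam * t)) * ((lam * t) ^ m / fact m)))
      sums (exp (- (lam * t)) * exp (u * (lam * t)))"
    using sums_mult[OF exp_converges[of "u * (lam * t)"], of "exp (- (lam * t))"]
    by (simp add: field_simps power_mult_distrib)
  ultimately have "pgf M (N t) u = exp (- (lam * t)) * exp (u * (lam * t))"
    by (rule sums_unique2)
  also have "\<dots> = exp (- (lam * (1 - u)) * t)"
    by (simp add: exp_add[symmetric] algebra_simps)
  finally show ?thesis .
qed

text \<open>
  Discretises a time from the right on the grid of mesh \<open>1 / Suc m\<close>. The approximation must be
  strictly above \<open>v\<close>, because the paths are only right-continuous. It must take countably many
  values, because the product \<open>\<sigma>\<close>-algebra on paths makes evaluation measurable at each fixed time, and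
  from there only at random times with countably many values.
\<close>

definition grid_above :: "nat \<Rightarrow> real \<Rightarrow> real" where
  "grid_above m v = (of_int \<lfloor>real (Suc m) * v\<rfloor> + 1) / real (Suc m)"

lemma grid_above_gt: "v < grid_above m v"
proof -
  have "real (Suc m) * v < of_int \<lfloor>real (Suc m) * v\<rfloor> + 1"
    by (rule real_of_int_floor_add_one_gt)
  then show ?thesis
    by (simp add: grid_above_def pos_less_divide_eq mult.commute)
qed

lemma grid_above_le: "grid_above m v \<le> v + 1 / real (Suc m)"
proof -
  have "of_int \<lfloor>real (Suc m) * v\<rfloor> \<le> real (Suc m) * v"
    by (rule of_int_floor_le)
  then have "of_int \<lfloor>real (Suc m) * v\<rfloor> / real (Suc m) \<le> v"
    by (subst pos_divide_le_eq) (auto simp: mult.commute)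
  then show ?thesis
    by (simp add: grid_above_def add_divide_distrib)
qed

lemma filterlim_grid_above: "filterlim (\<lambda>m. grid_above m v) (at_right v) sequentially"
proof -
  have "(\<lambda>m. 1 / real (Suc m)) \<longlonglongrightarrow> 0"
    by (rule LIMSEQ_Suc[OF lim_1_over_n])
  then have "(\<lambda>m. v + 1 / real (Suc m)) \<longlonglongrightarrow> v"
    using tendsto_add[OF tendsto_const, of _ 0 sequentially v] by simp
  then have "(\<lambda>m. grid_above m v) \<longlonglongrightarrow> v"
    by (rule tendsto_sandwich[OF _ _ tendsto_const, rotated -1])
       (use grid_above_le less_imp_le[OF grid_above_gt] in \<open>blast intro: always_eventually\<close>)+
  then show ?thesis
    using grid_above_gt by (simp add: filterlim_at less_imp_neq[symmetric])
qed

text \<open>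
  A right-continuous integer-valued path is eventually constant along the grid, so the power
  converges for negative and zero bases as well.
\<close>

lemma tendsto_along_grid_above:
  fixes X :: "real \<Rightarrow> nat"
  assumes "continuous (at_right v) (\<lambda>t. real (X t))"
  shows "(\<lambda>m. u ^ X (grid_above m v)) \<longlonglongrightarrow> (u :: real) ^ X v"
proof -
  have "((\<lambda>t. real (X t)) \<longlongrightarrow> real (X v)) (at_right v)"
    using assms by (simp add: continuous_within)
  then have "(\<lambda>m. real (X (grid_above m v))) \<longlonglongrightarrow> real (X v)"
    by (rule filterlim_compose[OF _ filterlim_grid_above])
  then have "\<forall>\<^sub>F m in sequentially. dist (real (X (grid_above m v))) (real (X v)) < 1"
    by (rule tendstoD) simp
  then have "\<forall>\<^sub>F m in sequentially. u ^ X (grid_above m v) = u ^ X v"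
  proof eventually_elim
    case (elim m)
    then have "X (grid_above m v) = X v"
      by (simp add: dist_real_def abs_less_iff)
    then show ?case
      by simp
  qed
  then show ?thesis
    by (rule tendsto_eventually)
qed

text \<open>
  If the clock \<open>V t\<close> takes countably many values, this is Fubini's theorem for the joint law of the
  two paths, which independence makes a product. The general case follows by discretising the clock
  from the right and applying dominated convergence on both sides, all integrands being bounded by
  \<open>1\<close>.
\<close>

lemma pgf_time_change:
  fixes X :: "real \<Rightarrow> 'w \<Rightarrow> nat" and V :: "real \<Rightarrow> 'w \<Rightarrow> real"
  assumes "prob_space M"
    and X: "\<And>t. 0 \<le> t \<Longrightarrow> X t \<in> measurable M (count_space UNIV)"
    and rc: "\<And>t \<omega>. 0 \<le> t \<Longrightarrow> \<omega> \<in> space M \<Longrightarrow> continuous (at_right t) (\<lambda>r. real (X r \<omega>))"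
    and V0: "\<And>\<omega>. \<omega> \<in> space M \<Longrightarrow> 0 \<le> V t \<omega>"
    and ind: "indep_processes M (\<lambda>t \<omega>. real (X t \<omega>)) V"
    and t: "0 \<le> t"
    and u: "u \<in> {-1..1}"
  shows "pgf M (time_change X V t) u = (\<integral>\<omega>. pgf M (X (V t \<omega>)) u \<partial>M)"
proof -
  interpret prob_space M by fact
  let ?P = "PiM {0..} (\<lambda>_. borel) :: (real \<Rightarrow> real) measure"
  let ?X = "sample_path (\<lambda>t \<omega>. real (X t \<omega>))"
  let ?V = "sample_path V"
  let ?D = "distr M ?P ?X"
  let ?E = "distr M ?P ?V"
  have X'[measurable]: "?X \<in> measurable M ?P" and V'[measurable]: "?V \<in> measurable M ?P"
    and joint: "distr M (?P \<Otimes>\<^sub>M ?P) (\<lambda>\<omega>. (?X \<omega>, ?V \<omega>)) = ?D \<Otimes>\<^sub>M ?E"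
    using ind by (auto simp: indep_processes_def indep_var_distribution_eq)
  interpret D: prob_space ?D by (rule prob_space_distr) simp
  interpret E: prob_space ?E by (rule prob_space_distr) simp
  interpret DE: pair_prob_space ?D ?E ..
  have bnd: "\<bar>u ^ n\<bar> \<le> 1" for n :: nat
    using u by (auto simp: power_abs intro!: power_le_one)
  \<comment> \<open>The absolute value keeps the evaluation time in the index set \<open>{0..}\<close>, and \<open>nat \<lfloor>_\<rfloor>\<close> recovers the
    integer value of the first path. Neither changes the value on the paths of \<open>X\<close> and \<open>V\<close>.\<close>
  define F where "F m p = u ^ nat \<lfloor>fst p (grid_above m \<bar>snd p t\<bar>)\<rfloor>"
    for m and p :: "(real \<Rightarrow> real) \<times> (real \<Rightarrow> real)"
  have F[measurable]: "F m \<in> borel_measurable (?P \<Otimes>\<^sub>M ?P)" for m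
  proof -
    let ?G = "\<lambda>i p. u ^ nat \<lfloor>fst p ((of_int \<bar>i\<bar> + 1) / real (Suc m))\<rfloor>"
    let ?g = "\<lambda>p. \<lfloor>real (Suc m) * \<bar>snd p t\<bar>\<rfloor>"
    have floor: "(\<lambda>x :: real. \<lfloor>c * x\<rfloor>) \<in> measurable borel (count_space UNIV)" for c
      by measurable
    have comp: "(\<lambda>p. snd p t) \<in> borel_measurable (?P \<Otimes>\<^sub>M ?P)"
      using t by (intro measurable_compose[OF measurable_snd measurable_component_singleton]) simp
    have "(\<lambda>p. ?G (?g p) p) \<in> borel_measurable (?P \<Otimes>\<^sub>M ?P)"
    proof (rule measurable_compose_countable[where f = ?G and g = ?g])
      fix i :: int
      have "(\<lambda>p. fst p ((of_int \<bar>i\<bar> + 1) / real (Suc m))) \<in> borel_measurable (?P \<Otimes>\<^sub>M ?P)"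
        by (rule measurable_compose[OF measurable_fst measurable_component_singleton]) simp
      then have "(\<lambda>p. \<lfloor>1 * fst p ((of_int \<bar>i\<bar> + 1) / real (Suc m))\<rfloor>)
          \<in> measurable (?P \<Otimes>\<^sub>M ?P) (count_space UNIV)"
        by (rule measurable_compose[OF _ floor])
      then show "?G i \<in> borel_measurable (?P \<Otimes>\<^sub>M ?P)"
        unfolding mult_1 by (rule measurable_compose[where g = "\<lambda>n. u ^ nat n"]) simp
    next
      have "(\<lambda>p. \<bar>snd p t\<bar>) \<in> borel_measurable (?P \<Otimes>\<^sub>M ?P)"
        using comp by (rule borel_measurable_abs)
      then show "?g \<in> measurable (?P \<Otimes>\<^sub>M ?P) (count_space UNIV)"
        by (rule measurable_compose[OF _ floor])
    qed
    also have "(\<lambda>p. ?G (?g p) p) = F m"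
    proof
      fix p :: "(real \<Rightarrow> real) \<times> (real \<Rightarrow> real)"
      have "\<bar>\<lfloor>real (Suc m) * \<bar>snd p t\<bar>\<rfloor>\<bar> = \<lfloor>real (Suc m) * \<bar>snd p t\<bar>\<rfloor>"
        by (intro abs_of_nonneg) (simp del: of_nat_Suc)
      then show "?G (?g p) p = F m p"
        by (simp only: F_def grid_above_def)
    qed
    finally show ?thesis .
  qed
  have gpos: "0 \<le> grid_above m \<bar>v\<bar>" for m v
    using grid_above_gt[of "\<bar>v\<bar>" m] by linarith
  have FX: "F m (?X \<omega>, y) = u ^ X (grid_above m \<bar>y t\<bar>) \<omega>" for m \<omega> y
    using gpos by (simp add: F_def sample_path_def)
  have Vt: "?V \<omega> t = V t \<omega>" for \<omega>
    using t by (simp add: sample_path_def)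
  have intF: "integrable (?D \<Otimes>\<^sub>M ?E) (F m)" for m
  proof (rule DE.P.integrable_const_bound[where B = 1])
    show "AE p in ?D \<Otimes>\<^sub>M ?E. norm (F m p) \<le> 1"
      by (simp add: F_def bnd)
    show "F m \<in> borel_measurable (?D \<Otimes>\<^sub>M ?E)"
      using F by (simp cong: measurable_cong_sets sets_pair_measure_cong)
  qed
  have pgfD: "(\<integral>x. F m (x, y) \<partial>?D) = pgf M (X (grid_above m \<bar>y t\<bar>)) u" if "y \<in> space ?P" for m y
    using that by (subst integral_distr) (auto simp: FX pgf_def)
  have "(\<integral>\<omega>. u ^ X (grid_above m (V t \<omega>)) \<omega> \<partial>M)
      = (\<integral>\<omega>. pgf M (X (grid_above m (V t \<omega>))) u \<partial>M)" for m
  proof -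
    have "(\<integral>\<omega>. u ^ X (grid_above m (V t \<omega>)) \<omega> \<partial>M) = (\<integral>\<omega>. F m (?X \<omega>, ?V \<omega>) \<partial>M)"
      using V0 by (intro Bochner_Integration.integral_cong) (auto simp: FX Vt)
    also have "\<dots> = (\<integral>p. F m p \<partial>distr M (?P \<Otimes>\<^sub>M ?P) (\<lambda>\<omega>. (?X \<omega>, ?V \<omega>)))"
      by (subst integral_distr) auto
    also have "\<dots> = (\<integral>y. \<integral>x. F m (x, y) \<partial>?D \<partial>?E)"
      unfolding joint
      by (rule DE.integral_snd[of "\<lambda>x y. F m (x, y)", symmetric, simplified, OF intF])
    also have "\<dots> = (\<integral>\<omega>. \<integral>x. F m (x, ?V \<omega>) \<partial>?D \<partial>M)"
      by (subst integral_distr) auto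
    also have "\<dots> = (\<integral>\<omega>. pgf M (X (grid_above m (V t \<omega>))) u \<partial>M)"
      using V0 measurable_space[OF V']
      by (intro Bochner_Integration.integral_cong) (auto simp: pgfD Vt)
    finally show ?thesis .
  qed
  moreover
  have pmeas: "(\<lambda>\<omega>. pgf M (X (grid_above m (V t \<omega>))) u) \<in> borel_measurable M" for m
  proof -
    have meas: "(\<lambda>\<omega>. \<integral>x. F m (x, ?V \<omega>) \<partial>?D) \<in> borel_measurable M"
      by measurable
    have eq: "(\<integral>x. F m (x, ?V \<omega>) \<partial>?D) = pgf M (X (grid_above m (V t \<omega>))) u"
      if "\<omega> \<in> space M" for \<omega>
      using V0[OF that] measurable_space[OF V' that] by (simp add: pgfD Vt)
    show ?thesis
      by (rule measurable_cong[THEN iffD1, OF eq meas])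
  qed
  have umeas: "(\<lambda>\<omega>. u ^ X (grid_above m (V t \<omega>)) \<omega>) \<in> borel_measurable M" for m
  proof -
    have meas: "(\<lambda>\<omega>. F m (?X \<omega>, ?V \<omega>)) \<in> borel_measurable M"
      by measurable
    have eq: "F m (?X \<omega>, ?V \<omega>) = u ^ X (grid_above m (V t \<omega>)) \<omega>"
      if "\<omega> \<in> space M" for \<omega>
      using V0[OF that] by (simp add: FX Vt)
    show ?thesis
      by (rule measurable_cong[THEN iffD1, OF eq meas])
  qed
  have ulim: "(\<lambda>m. u ^ X (grid_above m v) \<omega>) \<longlonglongrightarrow> u ^ X v \<omega>" if "0 \<le> v" "\<omega> \<in> space M" for v \<omega>
    using rc[OF that] by (rule tendsto_along_grid_above)
  have "(\<lambda>\<omega>. u ^ X (V t \<omega>) \<omega>) \<in> borel_measurable M"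
    using ulim V0 by (intro borel_measurable_LIMSEQ_real[where u = "\<lambda>m \<omega>. u ^ X (grid_above m (V t \<omega>)) \<omega>", OF _ umeas]) auto
  then have "(\<lambda>m. \<integral>\<omega>. u ^ X (grid_above m (V t \<omega>)) \<omega> \<partial>M) \<longlonglongrightarrow> (\<integral>\<omega>. u ^ X (V t \<omega>) \<omega> \<partial>M)"
    by (rule integral_dominated_convergence[where w = "\<lambda>_. 1", OF _ umeas])
       (use V0 ulim bnd in auto)
  moreover
  have plim: "(\<lambda>m. pgf M (X (grid_above m v)) u) \<longlonglongrightarrow> pgf M (X v) u" if "0 \<le> v" for v
  proof -
    have "X (grid_above m v) \<in> measurable M (count_space UNIV)" for m
      using X gpos[of m v] that by auto
    note [measurable] = this X[OF that]
    show ?thesis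
      unfolding pgf_def using that ulim bnd
      by (intro integral_dominated_convergence[where w = "\<lambda>_. 1"]) auto
  qed
  have pbnd: "\<bar>pgf M (X v) u\<bar> \<le> 1" if "0 \<le> v" for v
  proof -
    note [measurable] = X[OF that]
    have "\<bar>pgf M (X v) u\<bar> \<le> (\<integral>\<omega>. \<bar>u ^ X v \<omega>\<bar> \<partial>M)"
      unfolding pgf_def by (rule integral_abs_bound)
    also have "\<dots> \<le> (\<integral>\<omega>. 1 \<partial>M)"
      using bnd by (intro integral_mono integrable_const_bound[where B = 1]) auto
    finally show ?thesis by (simp add: prob_space)
  qed
  have "(\<lambda>\<omega>. pgf M (X (V t \<omega>)) u) \<in> borel_measurable M"
    using plim V0 by (intro borel_measurable_LIMSEQ_real[where u = "\<lambda>m \<omega>. pgf M (X (grid_above m (V t \<omega>))) u", OF _ pmeas]) auto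
  then have "(\<lambda>m. \<integral>\<omega>. pgf M (X (grid_above m (V t \<omega>))) u \<partial>M) \<longlonglongrightarrow> (\<integral>\<omega>. pgf M (X (V t \<omega>)) u \<partial>M)"
  proof (rule integral_dominated_convergence[where w = "\<lambda>_. 1", OF _ pmeas])
    show "AE \<omega> in M. norm (pgf M (X (grid_above m (V t \<omega>))) u) \<le> 1" for m
    proof (rule AE_I2)
      fix \<omega> assume w: "\<omega> \<in> space M"
      have "0 \<le> grid_above m (V t \<omega>)"
        using gpos[of m "V t \<omega>"] V0[OF w] by simp
      then show "norm (pgf M (X (grid_above m (V t \<omega>))) u) \<le> 1"
        using pbnd by simp
    qed
  qed (use V0 plim in auto)
  ultimately show ?thesis
    unfolding pgf_def[of M "time_change X V t"] time_change_def by (simp add: LIMSEQ_unique)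
qed

section \<open>The Laplace transform of the variable-order stable subordinator\<close>

lemma pieces_atLeastAtMost_subset:
  assumes bp: "breakpoints s" and k: "s (k - 1) \<le> ereal t"
  shows "{1..k} \<subseteq> pieces s"
proof
  fix j assume "j \<in> {1..k}"
  moreover from this have "s (j - 1) \<le> s (k - 1)"
    using bp by (intro monoD[of s]) (auto simp: breakpoints_def)
  ultimately show "j \<in> pieces s"
    using k order.strict_trans1[of _ "ereal t" \<infinity>] by (auto simp: pieces_def)
qed

lemma breakpoints_strict: "breakpoints s \<Longrightarrow> s j < \<infinity> \<Longrightarrow> s j < s (Suc j)"
  by (simp add: breakpoints_def)

lemma breakpoints_nonneg: "breakpoints s \<Longrightarrow> 0 \<le> s j"
  using monoD[of s 0 j] by (auto simp: breakpoints_def)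

lemma ereal_real_breakpoint:
  assumes "breakpoints s" "s j < \<infinity>"
  shows "ereal (real_of_ereal (s j)) = s j"
  using assms breakpoints_nonneg[of s j] by (cases "s j") auto

lemma breakpoint_diff_nonneg:
  assumes "breakpoints s"
  shows "0 \<le> real_of_ereal (s j - s (j - 1))"
  using monoD[of s "j - 1" j] assms breakpoints_nonneg[of s "j - 1"]
  by (cases "s j"; cases "s (j - 1)") (auto simp: breakpoints_def)

text \<open>
  The pieces, closed on the right instead of on the left, also cover the positive half-line; left
  derivatives are computed on the piece found here.
\<close>

lemma exists_piece_from_left:
  assumes "breakpoints s" and t: "0 < t"
  shows "\<exists>k\<ge>1. s (k - 1) < ereal t \<and> ereal t \<le> s k"
proof -
  have lim: "s \<longlonglongrightarrow> \<infinity>" and s0: "s 0 = 0"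
    using assms(1) by (auto simp: breakpoints_def)
  have "\<forall>\<^sub>F j in sequentially. ereal t < s j"
    using order_tendstoD(1)[OF lim, of "ereal t"] by simp
  then have ex: "\<exists>j. ereal t \<le> s j"
    by (auto simp: eventually_sequentially intro: less_imp_le)
  define k where "k = (LEAST j. ereal t \<le> s j)"
  have k: "ereal t \<le> s k"
    unfolding k_def using ex by (rule LeastI_ex)
  have "k \<noteq> 0"
    using k s0 t by (intro notI) simp
  moreover from this have "\<not> ereal t \<le> s (k - 1)"
    using not_less_Least[of "k - 1" "\<lambda>j. ereal t \<le> s j"] by (simp add: k_def)
  ultimately show ?thesis
    using k by (intro exI[of _ k]) auto
qed

lemma piece_at_eq:
  assumes "breakpoints s" and "1 \<le> k" "s (k - 1) \<le> ereal t" "ereal t < s k"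
  shows "piece_at s t = k"
proof -
  have "0 \<le> t"
    using breakpoints_nonneg[OF assms(1), of "k - 1"] assms(3)
    by (metis ereal_less_eq(5) order_trans)
  then show ?thesis
    unfolding piece_at_def using assms by (intro the1_equality piece_at_unique) auto
qed

text \<open>
  The length of time for which the \<open>j\<close>-th subordinator has run by time \<open>t\<close>, when \<open>k\<close> is the piece in
  progress. The piece is an argument, not computed from \<open>t\<close>, so that \<open>voss_exponent\<close> below
  extends affinely beyond its piece and can be differentiated at the breakpoints.
\<close>

definition time_spent :: "(nat \<Rightarrow> ereal) \<Rightarrow> nat \<Rightarrow> real \<Rightarrow> nat \<Rightarrow> real" where
  "time_spent s k t j = (if j < k then real_of_ereal (s j - s (j - 1)) else t - real_of_ereal (s (k - 1)))"

lemma time_spent_nonneg: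
  assumes "breakpoints s" "s (k - 1) \<le> ereal t"
  shows "0 \<le> time_spent s k t j"
  using breakpoint_diff_nonneg[OF assms(1), of j] assms(2) breakpoints_nonneg[OF assms(1), of "k - 1"]
  by (cases "s (k - 1)") (auto simp: time_spent_def)

lemma sum_split_last:
  fixes f :: "nat \<Rightarrow> real"
  assumes "1 \<le> k"
  shows "sum f {1..k} = sum f {1..k - 1} + f k"
  using assms by (cases k) auto

lemma voss_eq_sum_time_spent:
  assumes "breakpoints s" and "1 \<le> k" "s (k - 1) \<le> ereal t" "ereal t < s k"
  shows "voss s S t \<omega> = (\<Sum>j=1..k. S j (time_spent s k t j) \<omega>)"
proof -
  have "(\<Sum>j = 1..k - 1. S j (real_of_ereal (s j - s (j - 1))) \<omega>)
      = (\<Sum>j = 1..k - 1. S j (time_spent s k t j) \<omega>)"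
    by (intro sum.cong) (auto simp: time_spent_def)
  then show ?thesis
    unfolding sum_split_last[OF assms(2)]
    by (simp add: voss_def piece_at_eq[OF assms]) (simp add: time_spent_def)
qed

lemma stable_subordinator_nonneg:
  assumes "stable_subordinator M b X" "0 \<le> t" "\<omega> \<in> space M"
  shows "0 \<le> X t \<omega>"
proof -
  have "mono_on {0..} (\<lambda>r. X r \<omega>)" "X 0 \<omega> = 0"
    using assms by (auto simp: stable_subordinator_def nondecreasing_paths_def levy_process_def)
  then show ?thesis
    using mono_onD[of "{0..}" "\<lambda>r. X r \<omega>" 0 t] assms(2) by auto
qed

lemma voss_nonneg:
  assumes bp: "breakpoints s" and fam: "indep_stable_family M s a S"
    and t: "0 \<le> t" and \<omega>: "\<omega> \<in> space M"
  shows "0 \<le> voss s S t \<omega>"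
proof -
  obtain k where k: "1 \<le> k" "s (k - 1) \<le> ereal t" "ereal t < s k"
    using piece_at_unique[OF bp t] by blast
  have "0 \<le> S j (time_spent s k t j) \<omega>" if j: "j \<in> {1..k}" for j
  proof -
    have "j \<in> pieces s"
      using pieces_atLeastAtMost_subset[OF bp k(2)] j by blast
    then have "stable_subordinator M (a j) (S j)"
      using fam by (auto simp: indep_stable_family_def)
    then show ?thesis
      by (rule stable_subordinator_nonneg[OF _ time_spent_nonneg[OF bp k(2)] \<omega>])
  qed
  then show ?thesis
    unfolding voss_eq_sum_time_spent[OF bp k] by (rule sum_nonneg)
qed

definition voss_exponent :: "(nat \<Rightarrow> ereal) \<Rightarrow> (nat \<Rightarrow> real) \<Rightarrow> real \<Rightarrow> nat \<Rightarrow> real \<Rightarrow> real" where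
  "voss_exponent s a w k t = (\<Sum>j=1..k. time_spent s k t j * w powr a j)"

text \<open>
  The factors \<open>exp (- w * S j _)\<close> are independent and bounded by \<open>1\<close>, so the expectation of their
  product is the product of the stable Laplace transforms.
\<close>

lemma voss_laplace_transform:
  assumes "prob_space M" and bp: "breakpoints s" and fam: "indep_stable_family M s a S"
    and k: "1 \<le> k" "s (k - 1) \<le> ereal t" "ereal t < s k" and w: "0 \<le> w"
  shows "(\<integral>\<omega>. exp (- w * voss s S t \<omega>) \<partial>M) = exp (- voss_exponent s a w k t)"
proof -
  interpret prob_space M by fact
  let ?P = "PiM {0..} (\<lambda>_. borel) :: (real \<Rightarrow> real) measure"
  let ?T = "time_spent s k t"
  have sub: "{1..k} \<subseteq> pieces s"
    by (rule pieces_atLeastAtMost_subset[OF bp k(2)])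
  have T: "0 \<le> ?T j" for j
    using time_spent_nonneg[OF bp k(2)] .
  have st: "stable_subordinator M (a j) (S j)" if "j \<in> {1..k}" for j
    using fam sub that by (auto simp: indep_stable_family_def)
  have "indep_vars (\<lambda>_. ?P) (\<lambda>j. sample_path (S j)) {1..k}"
    using fam sub by (auto simp: indep_stable_family_def intro: indep_vars_subset)
  then have "indep_vars (\<lambda>_. borel) (\<lambda>j \<omega>. exp (- w * sample_path (S j) \<omega> (?T j))) {1..k}"
  proof (rule indep_vars_compose2)
    fix j
    have [measurable]: "(\<lambda>y. y (?T j)) \<in> borel_measurable ?P"
      using T by (intro measurable_component_singleton) simp
    show "(\<lambda>y. exp (- w * y (?T j))) \<in> borel_measurable ?P"
      by measurable
  qed
  then have ind: "indep_vars (\<lambda>_. borel) (\<lambda>j \<omega>. exp (- w * S j (?T j) \<omega>)) {1..k}"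
    using T by (simp add: sample_path_def)
  have int: "integrable M (\<lambda>\<omega>. exp (- w * S j (?T j) \<omega>))" if j: "j \<in> {1..k}" for j
  proof (rule integrable_const_bound[where B = 1])
    show "AE \<omega> in M. norm (exp (- w * S j (?T j) \<omega>)) \<le> 1"
    proof (rule AE_I2)
      fix \<omega> assume "\<omega> \<in> space M"
      then have "0 \<le> S j (?T j) \<omega>"
        by (rule stable_subordinator_nonneg[OF st[OF j] T])
      then show "norm (exp (- w * S j (?T j) \<omega>)) \<le> 1"
        using w by simp
    qed
    show "(\<lambda>\<omega>. exp (- w * S j (?T j) \<omega>)) \<in> borel_measurable M"
      using ind j by (auto simp: indep_vars_def)
  qed
  have "(\<integral>\<omega>. exp (- w * voss s S t \<omega>) \<partial>M) = (\<integral>\<omega>. (\<Prod>j\<in>{1..k}. exp (- w * S j (?T j) \<omega>)) \<partial>M)"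
    by (simp add: voss_eq_sum_time_spent[OF bp k] exp_sum sum_distrib_left flip: sum_negf)
  also have "\<dots> = (\<Prod>j\<in>{1..k}. \<integral>\<omega>. exp (- w * S j (?T j) \<omega>) \<partial>M)"
    by (rule indep_vars_lebesgue_integral[OF _ ind int]) auto
  also have "\<dots> = (\<Prod>j\<in>{1..k}. exp (- ?T j * w powr a j))"
    using st T w by (intro prod.cong) (auto simp: stable_subordinator_def)
  also have "\<dots> = exp (- voss_exponent s a w k t)"
    by (simp add: voss_exponent_def exp_sum flip: sum_negf)
  finally show ?thesis .
qed

text \<open>
  When the piece \<open>k\<close> has just been completed, the next subordinator has run for time \<open>0\<close>. This
  equality carries the formula of a piece over to its right endpoint.
\<close>

lemma voss_exponent_at_breakpoint:
  assumes "breakpoints s" and k: "1 \<le> k" "s k = ereal t"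
  shows "voss_exponent s a w (Suc k) t = voss_exponent s a w k t"
proof -
  have "s (k - 1) \<le> s k"
    using assms(1) by (intro monoD[of s]) (auto simp: breakpoints_def)
  then have fin: "ereal (real_of_ereal (s (k - 1))) = s (k - 1)"
    using assms by (intro ereal_real_breakpoint) auto
  have "voss_exponent s a w (Suc k) t = (\<Sum>j=1..k. time_spent s (Suc k) t j * w powr a j)"
    using k by (simp add: voss_exponent_def time_spent_def)
  also have "\<dots> = voss_exponent s a w k t"
    unfolding voss_exponent_def
  proof (intro sum.cong refl)
    fix j assume j: "j \<in> {1..k}"
    have "s k - s (k - 1) = ereal (t - real_of_ereal (s (k - 1)))"
      using k(2) by (subst fin[symmetric]) simp
    then show "time_spent s (Suc k) t j * w powr a j = time_spent s k t j * w powr a j"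
      using j by (cases "j = k") (auto simp: time_spent_def)
  qed
  finally show ?thesis .
qed

lemma has_field_derivative_voss_exponent:
  assumes "1 \<le> k"
  shows "(voss_exponent s a w k has_real_derivative w powr a k) (at t within A)"
proof -
  have "((\<lambda>t. (\<Sum>j=1..k - 1. real_of_ereal (s j - s (j - 1)) * w powr a j)
      + (t - real_of_ereal (s (k - 1))) * w powr a k) has_real_derivative w powr a k) (at t within A)"
    by (auto intro!: derivative_eq_intros)
  also have "(\<lambda>t. (\<Sum>j=1..k - 1. real_of_ereal (s j - s (j - 1)) * w powr a j)
      + (t - real_of_ereal (s (k - 1))) * w powr a k) = voss_exponent s a w k"
    unfolding voss_exponent_def sum_split_last[OF assms]
    by (auto simp: fun_eq_iff time_spent_def intro!: sum.cong)
  finally show ?thesis .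
qed

lemma has_real_derivative_at_left_right:
  fixes f :: "real \<Rightarrow> real"
  assumes "(f has_real_derivative D) (at_left x)" "(f has_real_derivative D) (at_right x)"
  shows "(f has_real_derivative D) (at x)"
  using assms by (auto simp: has_field_derivative_iff filterlim_at_split)

section \<open>The differential equation of the generating function\<close>

theorem theorem3p1:
  fixes M :: "'w measure" and lam :: real
    and \<alpha> :: "real \<Rightarrow> real" and s :: "nat \<Rightarrow> ereal" and a :: "nat \<Rightarrow> real"
    and S :: "nat \<Rightarrow> real \<Rightarrow> 'w \<Rightarrow> real" and N :: "real \<Rightarrow> 'w \<Rightarrow> nat"
    and \<xi> :: "real \<Rightarrow> 'w \<Rightarrow> nat" and \<psi> :: "real \<Rightarrow> real \<Rightarrow> real" and u :: real
  assumes "prob_space M"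
    and "0 < lam"
    and "piecewise_constant_index s a \<alpha>"
    and "indep_stable_family M s a S"
    and "poisson_process M lam N"
    and "indep_processes M (\<lambda>t \<omega>. real (N t \<omega>)) (voss s S)"
    and "\<xi> = time_change N (voss s S)"
    and "\<psi> = (\<lambda>u t. pgf M (\<xi> t) u)"
    and "u \<in> {-1..1}"
  shows "continuous_on {0..} (\<psi> u)
    \<and> (\<forall>t>0. isCont \<alpha> t \<longrightarrow>
         (\<psi> u has_real_derivative - (lam powr \<alpha> t) * \<psi> u t * (1 - u) powr \<alpha> t) (at t))
    \<and> (\<forall>t\<ge>0.
         (\<psi> u has_real_derivative - (lam powr \<alpha> t) * \<psi> u t * (1 - u) powr \<alpha> t) (at_right t))
    \<and> \<psi> u 0 = 1"
proof -
  define w where "w = lam * (1 - u)"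
  have bp: "breakpoints s"
    using assms(3) by (simp add: piecewise_constant_index_def)
  have w: "0 \<le> w"
    using assms(2,9) by (simp add: w_def)
  have \<psi>_exponent: "\<psi> u t = exp (- voss_exponent s a w k t)"
    if k: "1 \<le> k" "s (k - 1) \<le> ereal t" "ereal t < s k" for k t
  proof -
    have t: "0 \<le> t"
      using breakpoints_nonneg[OF bp, of "k - 1"] k(2) by (metis ereal_less_eq(5) order_trans)
    have "pgf M (time_change N (voss s S) t) u = (\<integral>\<omega>. pgf M (N (voss s S t \<omega>)) u \<partial>M)"
      using assms(5) voss_nonneg[OF bp assms(4) t] t
      by (intro pgf_time_change assms(1,6,9))
         (auto simp: poisson_process_def levy_process_def cadlag_paths_def)
    also have "\<dots> = (\<integral>\<omega>. exp (- w * voss s S t \<omega>) \<partial>M)"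
      using poisson_process_pgf[OF assms(1,5,9)] voss_nonneg[OF bp assms(4) t]
      by (intro Bochner_Integration.integral_cong) (auto simp: w_def)
    also have "\<dots> = exp (- voss_exponent s a w k t)"
      by (rule voss_laplace_transform[OF assms(1) bp assms(4) k w])
    finally show ?thesis
      by (simp add: assms(7,8))
  qed
  have \<psi>_exponent_closed: "\<psi> u t = exp (- voss_exponent s a w k t)"
    if k: "1 \<le> k" "s (k - 1) \<le> ereal t" "ereal t \<le> s k" for k t
  proof (cases "ereal t < s k")
    case True
    then show ?thesis
      using \<psi>_exponent k by blast
  next
    case False
    then have sk: "s k = ereal t"
      using k(3) by simp
    have "s k < s (Suc k)"
      using sk by (intro breakpoints_strict[OF bp]) simp
    then have "\<psi> u t = exp (- voss_exponent s a w (Suc k) t)"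
      using sk by (intro \<psi>_exponent) auto
    then show ?thesis
      using voss_exponent_at_breakpoint[OF bp k(1) sk] by simp
  qed
  \<comment> \<open>The filter \<open>at t within A\<close> is \<open>at_right t\<close> or \<open>at_left t\<close> below, so that endpoints of pieces
    are covered.\<close>
  have within_piece: "(\<psi> u has_real_derivative - (lam powr a k) * \<psi> u t * (1 - u) powr a k) (at t within A)"
    if k: "1 \<le> k" "s (k - 1) \<le> ereal t" "ereal t \<le> s k"
      and A: "\<forall>\<^sub>F r in at t within A. s (k - 1) \<le> ereal r \<and> ereal r \<le> s k" for k t A
  proof -
    have "((\<lambda>r. exp (- voss_exponent s a w k r)) has_real_derivative
        exp (- voss_exponent s a w k t) * - (w powr a k)) (at t within A)"
      by (intro derivative_intros DERIV_chain'[OF _ DERIV_exp] has_field_derivative_voss_exponent k(1))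
    also have "exp (- voss_exponent s a w k t) * - (w powr a k)
        = - (lam powr a k) * \<psi> u t * (1 - u) powr a k"
      using assms(2,9) by (simp add: \<psi>_exponent_closed[OF k] w_def powr_mult)
    finally show ?thesis
    proof (rule has_field_derivative_cong_eventually[THEN iffD1, rotated -1])
      show "\<forall>\<^sub>F r in at t within A. exp (- voss_exponent s a w k r) = \<psi> u r"
        using A by eventually_elim (simp add: \<psi>_exponent_closed[OF k(1)])
    qed (simp add: \<psi>_exponent_closed[OF k])
  qed
  have right: "(\<psi> u has_real_derivative - (lam powr \<alpha> t) * \<psi> u t * (1 - u) powr \<alpha> t) (at_right t)"
    if t: "0 \<le> t" for t
  proof -
    obtain k where k: "1 \<le> k" "s (k - 1) \<le> ereal t" "ereal t < s k"
      using piece_at_unique[OF bp t] by blast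
    have "k \<in> pieces s"
      using pieces_atLeastAtMost_subset[OF bp k(2)] k(1) by auto
    then have "\<alpha> t = a k"
      using assms(3) k by (auto simp: piecewise_constant_index_def)
    moreover have "\<forall>\<^sub>F r in at_right t. s (k - 1) \<le> ereal r \<and> ereal r \<le> s k"
    proof -
      have "((\<lambda>r. ereal r) \<longlongrightarrow> ereal t) (at_right t)"
        by (intro tendsto_intros)
      then have "\<forall>\<^sub>F r in at_right t. ereal r < s k"
        using k(3) by (rule order_tendstoD)
      moreover have "\<forall>\<^sub>F r in at_right t. t < r"
        by (rule eventually_at_right_less)
      ultimately show ?thesis
      proof eventually_elim
        case (elim r)
        then show ?case
          using k(2) order_trans[of "s (k - 1)" "ereal t" "ereal r"] by auto
      qed
    qed
    ultimately show ?thesis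
      using within_piece[of k t] k by simp
  qed
  \<comment> \<open>The exponent of the left derivative is identified as a left limit of \<open>\<alpha>\<close>, which continuity of
    \<open>\<alpha>\<close> at \<open>t\<close> then forces to be \<open>\<alpha> t\<close>.\<close>
  have left: "\<exists>b. (\<psi> u has_real_derivative - (lam powr b) * \<psi> u t * (1 - u) powr b) (at_left t)
      \<and> (\<alpha> \<longlongrightarrow> b) (at_left t)"
    if t: "0 < t" for t
  proof -
    obtain k where k: "1 \<le> k" "s (k - 1) < ereal t" "ereal t \<le> s k"
      using exists_piece_from_left[OF bp t] by blast
    have "((\<lambda>r. ereal r) \<longlongrightarrow> ereal t) (at_left t)"
      by (intro tendsto_intros)
    then have "\<forall>\<^sub>F r in at_left t. s (k - 1) < ereal r"
      using k(2) by (rule order_tendstoD)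
    moreover have "\<forall>\<^sub>F r in at_left t. r < t"
      by (simp add: eventually_at_filter)
    ultimately have piece: "\<forall>\<^sub>F r in at_left t. s (k - 1) \<le> ereal r \<and> ereal r < s k"
    proof eventually_elim
      case (elim r)
      then show ?case
        using k(3) order.strict_trans2[of "ereal r" "ereal t" "s k"] by auto
    qed
    have "k \<in> pieces s"
      using pieces_atLeastAtMost_subset[OF bp less_imp_le[OF k(2)]] k(1) by auto
    then have "\<alpha> r = a k" if "s (k - 1) \<le> ereal r \<and> ereal r < s k" for r
      using that assms(3) by (auto simp: piecewise_constant_index_def)
    then have "\<forall>\<^sub>F r in at_left t. \<alpha> r = a k"
      using piece by (rule eventually_mono[rotated])
    then have "(\<alpha> \<longlongrightarrow> a k) (at_left t)"
      by (rule tendsto_eventually)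
    moreover have "(\<psi> u has_real_derivative - (lam powr a k) * \<psi> u t * (1 - u) powr a k) (at_left t)"
      using k piece by (intro within_piece) (auto elim: eventually_mono)
    ultimately show ?thesis
      by blast
  qed
  have two_sided: "(\<psi> u has_real_derivative - (lam powr \<alpha> t) * \<psi> u t * (1 - u) powr \<alpha> t) (at t)"
    if t: "0 < t" and cont: "isCont \<alpha> t" for t
  proof -
    obtain b where b: "(\<psi> u has_real_derivative - (lam powr b) * \<psi> u t * (1 - u) powr b) (at_left t)"
      "(\<alpha> \<longlongrightarrow> b) (at_left t)"
      using left[OF t] by blast
    have "(\<alpha> \<longlongrightarrow> \<alpha> t) (at_left t)"
      using cont by (simp add: isCont_def filterlim_at_split)
    then have "b = \<alpha> t"
      using tendsto_unique[OF _ b(2)] by simp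
    then show ?thesis
      using b(1) right[of t] t by (intro has_real_derivative_at_left_right) auto
  qed
  have "continuous_on {0..} (\<psi> u)"
    unfolding continuous_on_eq_continuous_within
  proof
    fix t :: real assume "t \<in> {0..}"
    then have r: "continuous (at_right t) (\<psi> u)"
      by (intro DERIV_continuous[OF right]) simp
    show "continuous (at t within {0..}) (\<psi> u)"
    proof (cases "t = 0")
      case True
      have "{0..} - {0 :: real} = {0<..} - {0}"
        by auto
      then have "at (0 :: real) within {0..} = at_right 0"
        by (simp only: at_within_def)
      then show ?thesis
        using r True by simp
    next
      case False
      then have t: "0 < t"
        using \<open>t \<in> {0..}\<close> by simp
      then have "continuous (at_left t) (\<psi> u)"
        using left[OF t] by (blast intro: DERIV_continuous)
      then have "isCont (\<psi> u) t"
        using r by (simp add: continuous_at_split)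
      then show ?thesis
        by (rule continuous_at_imp_continuous_at_within)
    qed
  qed
  moreover have "\<psi> u 0 = 1"
  proof -
    have "s 0 = 0" "s 0 < s 1"
      using bp breakpoints_strict[OF bp, of 0] by (auto simp: breakpoints_def)
    then have "\<psi> u 0 = exp (- voss_exponent s a w 1 0)"
      by (intro \<psi>_exponent) (auto simp: zero_ereal_def)
    then show ?thesis
      using \<open>s 0 = 0\<close> by (simp add: voss_exponent_def time_spent_def)
  qed
  ultimately show ?thesis
    using two_sided right by blast
qed

end
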